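(* For every $\mathcal{I}\in\mathsf{FCons}(\mathbb{Z})$, every $k\in\mathbb{N}$, all data words $w_0,w_1$ and positions $i_0,i_1\in\mathbb{N}$: $(w_0,i_0)$ and $(w_1,i_1)$ satisfy exactly the same formulas of $\mathrm{MTL}^{\mathcal{I}}_k$ if and only if Duplicator has a winning strategy in the game $\mathrm{MG}^{\mathcal{I}}_k(w_0,i_0,w_1,i_1)$.
   Context: Data words: infinite sequences $w=(P_0,d_0)(P_1,d_1)\dots$, $P_i\subseteq\mathcal{P}$ ($\mathcal{P}$ a finite set of propositions), $d_i\in\mathbb{N}$; write $P^w_i,d^w_i$. MTL formulas: $\varphi::=p\mid\neg\varphi\mid\varphi_1\wedge\varphi_2\mid\varphi_1\mathsf{U}_I\varphi_2$ where $I$ is an integer interval with endpoints in $\mathbb{Z}\cup\{\pm\infty\}$; $(w,i)\models p$ iff $p\in P_i$, $(w,i)\models\varphi_1\mathsf{U}_I\varphi_2$ iff there is $j>i$ with $(w,j)\models\varphi_2$, $d_j-d_i\in I$, and $(w,k)\models\varphi_1$ for all $i<k<j$. Until rank: $\mathrm{urk}(p)=0$, $\mathrm{urk}(\neg\varphi)=\mathrm{urk}(\varphi)$, $\mathrm{urk}(\varphi_1\wedge\varphi_2)=\max$, $\mathrm{urk}(\varphi_1\mathsf{U}_I\varphi_2)=\max(\mathrm{urk}\varphi_1,\mathrm{urk}\varphi_2)+1$. $\mathsf{FCons}(\mathbb{Z})$ is the family of sets $S\cup\{-\infty,+\infty\}$ with $S\subseteq\mathbb{Z}$ finite. $\mathrm{MTL}^{\mathcal{I}}_k$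 is the set of MTL formulas of until rank $\le k$ all of whose interval endpoints lie in $\mathcal{I}$. Regions: $m,n\in\mathbb{Z}$ are in the same region w.r.t. $\mathcal{I}$ if either $m=n\in\mathcal{I}$, or $m,n\notin\mathcal{I}$ and they lie strictly between the same two consecutive elements of $\mathcal{I}$. Positions $i_0$ of $w_0$ and $i_1$ of $w_1$ agree in the propositional variables if $P^{w_0}_{i_0}=P^{w_1}_{i_1}$. Game $\mathrm{MG}^{\mathcal{I}}_k(w_0,i_0,w_1,i_1)$: if $k=0$, Spoiler wins iff $i_0,i_1$ do not agree in the propositional variables, otherwise Duplicator wins. If $k>0$: (1) if $i_0,i_1$ do not agree in the propositional variables Spoiler wins; otherwise Spoiler picks $l\in\{0,1\}$ and a position $i'_l>i_l$ in $w_l$. (2) Duplicator picks $i'_{1-l}>i_{1-l}$ in $w_{1-l}$; Spoiler wins unless $i'_0,i'_1$ agree in the propositional variables and $d^{w_0}_{i'_0}-d^{w_0}_{i_0}$ and $d^{w_1}_{i'_1}-d^{w_1}_{i_1}$ are in the same region w.r.t. $\mathcal{I}$. (3) Spoiler either continues with $\mathrm{MG}^{\mathcal{I}}_{k-1}(w_0,i'_0,w_1,i'_1)$, or (4) picks $i''_{1-l}$ with $i_{1-l}<i''_{1-l}<i'_{1-l}$, and Duplicator must pick $i''_l$ with $i_l<i''_l<i'_l$ such that $i''_0,i''_1$ agree in the propositional variables, else Spoiler wins; then (5) play continues with $\mathrm{MG}^{\mathcal{I}}_{k-1}(w_0,i''_0,w_1,i''_1)$. Duplicator has a winning strategy if she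 can avoid Spoiler winning in every round whatever Spoiler does. *)

theory Defs
  imports Main "HOL-Library.Extended"
begin

type_synonym 'p data_word = "nat \<Rightarrow> 'p set \<times> nat"

definition props :: "'p data_word \<Rightarrow> nat \<Rightarrow> 'p set" where
  "props w i = fst (w i)"

definition datum :: "'p data_word \<Rightarrow> nat \<Rightarrow> nat" where
  "datum w i = snd (w i)"

definition datum_diff :: "'p data_word \<Rightarrow> nat \<Rightarrow> nat \<Rightarrow> int" where
  "datum_diff w i j = int (datum w j) - int (datum w i)"

text \<open>Intervals are kept syntactic: as sets of integers, the closed interval from 1 to 2 and the
  open interval from 0 to 3 coincide, but only the written endpoints decide whether a formula
  belongs to a fragment of MTL. An infinite endpoint means the same whether it is included or not.\<close>

datatype interval =
    Closed "int extended" "int extended"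
  | Open "int extended" "int extended"
  | Left_Open "int extended" "int extended"
  | Right_Open "int extended" "int extended"

fun ints_in :: "interval \<Rightarrow> int set" where
  "ints_in (Closed a b) = {x. Fin x \<in> {a..b}}"
| "ints_in (Open a b) = {x. Fin x \<in> {a<..<b}}"
| "ints_in (Left_Open a b) = {x. Fin x \<in> {a<..b}}"
| "ints_in (Right_Open a b) = {x. Fin x \<in> {a..<b}}"

fun endpoints :: "interval \<Rightarrow> int extended set" where
  "endpoints (Closed a b) = {a, b}"
| "endpoints (Open a b) = {a, b}"
| "endpoints (Left_Open a b) = {a, b}"
| "endpoints (Right_Open a b) = {a, b}"

datatype 'p mtl =
    Prop 'p
  | Neg "'p mtl"
  | Conj "'p mtl" "'p mtl"
  | Until "'p mtl" interval "'p mtl"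

fun sat :: "'p data_word \<Rightarrow> nat \<Rightarrow> 'p mtl \<Rightarrow> bool" where
  "sat w i (Prop p) \<longleftrightarrow> p \<in> props w i"
| "sat w i (Neg \<phi>) \<longleftrightarrow> \<not> sat w i \<phi>"
| "sat w i (Conj \<phi> \<psi>) \<longleftrightarrow> sat w i \<phi> \<and> sat w i \<psi>"
| "sat w i (Until \<phi> I \<psi>) \<longleftrightarrow>
     (\<exists>j>i. sat w j \<psi> \<and> datum_diff w i j \<in> ints_in I \<and> (\<forall>k. i < k \<and> k < j \<longrightarrow> sat w k \<phi>))"

fun urk :: "'p mtl \<Rightarrow> nat" where
  "urk (Prop p) = 0"
| "urk (Neg \<phi>) = urk \<phi>"
| "urk (Conj \<phi> \<psi>) = max (urk \<phi>) (urk \<psi>)"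
| "urk (Until \<phi> I \<psi>) = max (urk \<phi>) (urk \<psi>) + 1"

fun mtl_endpoints :: "'p mtl \<Rightarrow> int extended set" where
  "mtl_endpoints (Prop p) = {}"
| "mtl_endpoints (Neg \<phi>) = mtl_endpoints \<phi>"
| "mtl_endpoints (Conj \<phi> \<psi>) = mtl_endpoints \<phi> \<union> mtl_endpoints \<psi>"
| "mtl_endpoints (Until \<phi> I \<psi>) = mtl_endpoints \<phi> \<union> endpoints I \<union> mtl_endpoints \<psi>"

definition FCons :: "int extended set set" where
  "FCons = {Fin ` S \<union> {Minf, Pinf} | S. finite S}"

definition MTL :: "int extended set \<Rightarrow> nat \<Rightarrow> 'p mtl set" where
  "MTL \<I> k = {\<phi>. urk \<phi> \<le> k \<and> mtl_endpoints \<phi> \<subseteq> \<I>}"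

definition consecutive :: "int extended set \<Rightarrow> int extended \<Rightarrow> int extended \<Rightarrow> bool" where
  "consecutive \<I> a b \<longleftrightarrow> a \<in> \<I> \<and> b \<in> \<I> \<and> a < b \<and> \<not> (\<exists>c\<in>\<I>. a < c \<and> c < b)"

definition same_region :: "int extended set \<Rightarrow> int \<Rightarrow> int \<Rightarrow> bool" where
  "same_region \<I> m n \<longleftrightarrow>
     (m = n \<and> Fin m \<in> \<I>) \<or>
     (Fin m \<notin> \<I> \<and> Fin n \<notin> \<I> \<and>
      (\<exists>a b. consecutive \<I> a b \<and> Fin m \<in> {a<..<b} \<and> Fin n \<in> {a<..<b}))"

text \<open>In the game, the two words and the positions marked in them are families indexed by
  \<^typ>\<open>bool\<close>, with index \<^term>\<open>False\<close> for 0 and \<^term>\<open>True\<close> for 1, so that the index $1-l$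
  is \<^term>\<open>\<not> l\<close>.\<close>

definition agree :: "(bool \<Rightarrow> 'p data_word) \<Rightarrow> (bool \<Rightarrow> nat) \<Rightarrow> bool" where
  "agree w i \<longleftrightarrow> props (w False) (i False) = props (w True) (i True)"

text \<open>
  \<^item> \<open>Round k i\<close>: the game with \<open>k\<close> rounds starts at the positions \<open>i\<close>.
  \<^item> \<open>Picked k i l m\<close>: Spoiler has picked the position \<open>m\<close> in word \<open>l\<close>, and \<open>k\<close> rounds remain after
    this one; Duplicator is to answer in word \<open>\<not> l\<close>.
  \<^item> \<open>Answered k i l i'\<close>: Duplicator has answered, so that the new positions are \<open>i'\<close>; Spoiler is to
    continue from \<open>i'\<close> or to pick a position strictly between \<open>i\<close> and \<open>i'\<close> in word \<open>\<not> l\<close>.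
  \<^item> \<open>Inner k i l i' m\<close>: Spoiler has picked such a position \<open>m\<close>; Duplicator is to answer in word \<open>l\<close>.
\<close>

datatype config =
    Round nat "bool \<Rightarrow> nat"
  | Picked nat "bool \<Rightarrow> nat" bool nat
  | Answered nat "bool \<Rightarrow> nat" bool "bool \<Rightarrow> nat"
  | Inner nat "bool \<Rightarrow> nat" bool "bool \<Rightarrow> nat" nat

inductive spoiler_move :: "(bool \<Rightarrow> 'p data_word) \<Rightarrow> config \<Rightarrow> config \<Rightarrow> bool"
  for w :: "bool \<Rightarrow> 'p data_word" where
  pick: "agree w i \<Longrightarrow> i l < m \<Longrightarrow> spoiler_move w (Round (Suc k) i) (Picked k i l m)"
| continue: "spoiler_move w (Answered k i l i') (Round k i')"
| pick_inner: "i (\<not> l) < m \<Longrightarrow> m < i' (\<not> l) \<Longrightarrow>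
    spoiler_move w (Answered k i l i') (Inner k i l i' m)"

text \<open>Only the moves of Duplicator with which she does not lose immediately.\<close>

inductive duplicator_move ::
    "int extended set \<Rightarrow> (bool \<Rightarrow> 'p data_word) \<Rightarrow> config \<Rightarrow> config \<Rightarrow> bool"
  for \<I> :: "int extended set" and w :: "bool \<Rightarrow> 'p data_word" where
  answer: "i' l = m \<Longrightarrow> i (\<not> l) < i' (\<not> l) \<Longrightarrow> agree w i' \<Longrightarrow>
    same_region \<I> (datum_diff (w False) (i False) (i' False))
                   (datum_diff (w True) (i True) (i' True)) \<Longrightarrow>
    duplicator_move \<I> w (Picked k i l m) (Answered k i l i')"
| answer_inner: "i'' (\<not> l) = m \<Longrightarrow> i l < i'' l \<Longrightarrow> i'' l < i' l \<Longrightarrow> agree w i'' \<Longrightarrow>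
    duplicator_move \<I> w (Inner k i l i' m) (Round k i'')"

fun duplicator_turn :: "config \<Rightarrow> bool" where
  "duplicator_turn (Round k i) = False"
| "duplicator_turn (Picked k i l m) = True"
| "duplicator_turn (Answered k i l i') = False"
| "duplicator_turn (Inner k i l i' m) = True"

text \<open>A strategy of Duplicator maps the history of the play, latest configuration first, to the
  configuration she moves to.\<close>

type_synonym strategy = "config list \<Rightarrow> config"

inductive play ::
    "int extended set \<Rightarrow> (bool \<Rightarrow> 'p data_word) \<Rightarrow> strategy \<Rightarrow> config \<Rightarrow> config list \<Rightarrow> bool"
  for \<I> :: "int extended set" and w :: "bool \<Rightarrow> 'p data_word"
    and \<sigma> :: strategy and c\<^sub>0 :: config where
  init: "play \<I> w \<sigma> c\<^sub>0 [c\<^sub>0]"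
| spoiler: "play \<I> w \<sigma> c\<^sub>0 (c # h) \<Longrightarrow> spoiler_move w c c' \<Longrightarrow> play \<I> w \<sigma> c\<^sub>0 (c' # c # h)"
| duplicator: "play \<I> w \<sigma> c\<^sub>0 (c # h) \<Longrightarrow> duplicator_move \<I> w c (\<sigma> (c # h)) \<Longrightarrow>
    play \<I> w \<sigma> c\<^sub>0 (\<sigma> (c # h) # c # h)"

fun spoiler_wins_at ::
    "int extended set \<Rightarrow> (bool \<Rightarrow> 'p data_word) \<Rightarrow> strategy \<Rightarrow> config list \<Rightarrow> bool" where
  "spoiler_wins_at \<I> w \<sigma> [] = False"
| "spoiler_wins_at \<I> w \<sigma> (c # h) \<longleftrightarrow>
     (\<exists>k i. c = Round k i \<and> \<not> agree w i) \<or>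
     (duplicator_turn c \<and> \<not> duplicator_move \<I> w c (\<sigma> (c # h)))"

text \<open>Every play ends after at most \<open>k\<close> rounds, and Spoiler can always move as long as a round is
  left, so Duplicator wins a play iff Spoiler does not win it at any point.\<close>

definition winning_strategy ::
    "int extended set \<Rightarrow> (bool \<Rightarrow> 'p data_word) \<Rightarrow> config \<Rightarrow> strategy \<Rightarrow> bool" where
  "winning_strategy \<I> w c\<^sub>0 \<sigma> \<longleftrightarrow>
     (\<forall>h. play \<I> w \<sigma> c\<^sub>0 h \<longrightarrow> \<not> spoiler_wins_at \<I> w \<sigma> h)"

definition duplicator_wins_MG ::
    "int extended set \<Rightarrow> nat \<Rightarrow> 'p data_word \<Rightarrow> nat \<Rightarrow> 'p data_word \<Rightarrow> nat \<Rightarrow> bool" where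
  "duplicator_wins_MG \<I> k w\<^sub>0 i\<^sub>0 w\<^sub>1 i\<^sub>1 \<longleftrightarrow>
     (\<exists>\<sigma>. winning_strategy \<I> (\<lambda>l. if l then w\<^sub>1 else w\<^sub>0) (Round k (\<lambda>l. if l then i\<^sub>1 else i\<^sub>0)) \<sigma>)"

end

theory Submission
  imports Defs
begin

text \<open>Duplicator wins iff the initial configuration lies in the greatest set of configurations in
  which Spoiler has not won and which Duplicator can avoid leaving; this reduces strategies to a
  recursive condition on the number of rounds. Given that condition, a formula
  $\varphi_1\mathsf{U}_I\varphi_2$ is transferred from one word to the other by letting Spoiler pick
  its witness, and then any position of the other word at which $\varphi_1$ could fail.
  Conversely, it is enough for Duplicator that the two positions satisfy the same formulas of a
  finite set $B_k$ of formulas of rank at most $k$. These sets are built recursively: if Spoiler picks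
  $m > i$, Duplicator finds her answer from the formula $\varphi_1\mathsf{U}_I\varphi_2$ of $B_{k+1}$,
  where $\varphi_2$ says which formulas of $B_k$ hold at $m$, $\varphi_1$ is the disjunction of the
  analogous formulas for the positions between $i$ and $m$, and $I$ is the region of the difference of
  the data values.\<close>

section \<open>Winning strategies as a greatest fixed point\<close>

coinductive safe :: "int extended set \<Rightarrow> (bool \<Rightarrow> 'p data_word) \<Rightarrow> config \<Rightarrow> bool"
  for \<I> :: "int extended set" and w :: "bool \<Rightarrow> 'p data_word" where
  "(\<And>k i. c = Round k i \<Longrightarrow> agree w i) \<Longrightarrow>
   (\<And>c'. spoiler_move w c c' \<Longrightarrow> safe \<I> w c') \<Longrightarrow>
   (duplicator_turn c \<Longrightarrow> \<exists>c'. duplicator_move \<I> w c c' \<and> safe \<I> w c') \<Longrightarrow>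
   safe \<I> w c"

lemma winning_strategy_imp_safe:
  assumes "winning_strategy \<I> w c \<sigma>"
  shows "safe \<I> w c"
proof -
  have not_lost: "\<not> spoiler_wins_at \<I> w \<sigma> h" if "play \<I> w \<sigma> c h" for h
    using assms that unfolding winning_strategy_def by blast
  have "safe \<I> w d" if "\<exists>h. play \<I> w \<sigma> c (d # h)" for d
    using that
  proof (coinduction arbitrary: d rule: safe.coinduct)
    case safe
    then obtain h where h: "play \<I> w \<sigma> c (d # h)" by blast
    have "duplicator_move \<I> w d (\<sigma> (d # h))" if "duplicator_turn d"
      using not_lost[OF h] that by simp
    then show ?case using h not_lost[OF h] by (auto intro: play.spoiler play.duplicator)
  qed
  then show ?thesis by (blast intro: play.init)
qed

lemma duplicator_move_imp_turn: "duplicator_move \<I> w c c' \<Longrightarrow> duplicator_turn c"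
  by (induction rule: duplicator_move.induct) auto

lemma safe_imp_winning_strategy:
  assumes "safe \<I> w c"
  shows "\<exists>\<sigma>. winning_strategy \<I> w c \<sigma>"
proof -
  define \<sigma> :: strategy where
    "\<sigma> h = (SOME c'. duplicator_move \<I> w (hd h) c' \<and> safe \<I> w c')" for h
  have stays_safe: "duplicator_move \<I> w d (\<sigma> (d # h)) \<and> safe \<I> w (\<sigma> (d # h))"
    if "safe \<I> w d" "duplicator_turn d" for d h
  proof -
    have "\<exists>c'. duplicator_move \<I> w d c' \<and> safe \<I> w c'"
      using that by (auto elim: safe.cases)
    then show ?thesis unfolding \<sigma>_def by (simp only: list.sel) (rule someI_ex)
  qed
  have play_safe: "h \<noteq> [] \<and> safe \<I> w (hd h)" if "play \<I> w \<sigma> c h" for h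
    using that
  proof induction
    case init
    then show ?case using assms by simp
  next
    case (spoiler d h c')
    then show ?case by (auto elim: safe.cases)
  next
    case (duplicator d h)
    then show ?case using stays_safe duplicator_move_imp_turn by fastforce
  qed
  have "\<not> spoiler_wins_at \<I> w \<sigma> (d # h)" if "safe \<I> w d" for d h
    using that stays_safe[OF that] by (auto elim: safe.cases)
  then have "winning_strategy \<I> w c \<sigma>"
    unfolding winning_strategy_def using play_safe by (metis list.collapse)
  then show ?thesis by blast
qed

lemma duplicator_wins_MG_iff_safe:
  "duplicator_wins_MG \<I> k w\<^sub>0 i\<^sub>0 w\<^sub>1 i\<^sub>1 \<longleftrightarrow>
    safe \<I> (\<lambda>l. if l then w\<^sub>1 else w\<^sub>0) (Round k (\<lambda>l. if l then i\<^sub>1 else i\<^sub>0))"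
  unfolding duplicator_wins_MG_def
  using winning_strategy_imp_safe safe_imp_winning_strategy by blast

lemma safe_Round_imp_agree: "safe \<I> w (Round k i) \<Longrightarrow> agree w i"
  by (auto elim: safe.cases)

lemma safe_Round_0: "safe \<I> w (Round 0 i) \<longleftrightarrow> agree w i"
  by (subst safe.simps) (auto elim: spoiler_move.cases)

lemma ex_bool_fun_iff: "(\<exists>f. P f) \<longleftrightarrow> (\<exists>a b. P ((\<lambda>_. b)(l := a)))" for l :: bool
proof
  assume "\<exists>f. P f"
  then obtain f where "P f" ..
  moreover have "f = (\<lambda>_. f (\<not> l))(l := f l)" by (auto simp: fun_eq_iff)
  ultimately show "\<exists>a b. P ((\<lambda>_. b)(l := a))" by metis
qed blast

text \<open>The positions \<open>(\<lambda>_. n)(l := m)\<close> are \<open>m\<close> in word \<open>l\<close> and \<open>n\<close> in the other word.\<close>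

lemma safe_Inner:
  "safe \<I> w (Inner k i l i' n) \<longleftrightarrow>
    (\<exists>m\<in>{i l<..<i' l}. safe \<I> w (Round k ((\<lambda>_. n)(l := m))))"
proof -
  have "safe \<I> w (Inner k i l i' n) \<longleftrightarrow>
      (\<exists>i''. i'' (\<not> l) = n \<and> i'' l \<in> {i l<..<i' l} \<and> safe \<I> w (Round k i''))"
    by (subst safe.simps)
      (auto elim!: spoiler_move.cases duplicator_move.cases
        intro: duplicator_move.answer_inner safe_Round_imp_agree)
  then show ?thesis by (simp add: ex_bool_fun_iff[where l = l] Bex_def)
qed

lemma safe_Answered:
  "safe \<I> w (Answered k i l i') \<longleftrightarrow>
    safe \<I> w (Round k i') \<and> (\<forall>n\<in>{i (\<not> l)<..<i' (\<not> l)}. safe \<I> w (Inner k i l i' n))"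
  by (subst safe.simps) (fastforce elim!: spoiler_move.cases intro: spoiler_move.intros)

lemma same_region_sym: "same_region \<I> m n \<Longrightarrow> same_region \<I> n m"
  unfolding same_region_def by blast

lemma same_region_bool_iff:
  "same_region \<I> (d False) (d True) \<longleftrightarrow> same_region \<I> (d l) (d (\<not> l))"
  by (cases l) (auto intro: same_region_sym)

lemma safe_Picked:
  "safe \<I> w (Picked k i l m) \<longleftrightarrow>
    (\<exists>n>i (\<not> l). same_region \<I> (datum_diff (w l) (i l) m) (datum_diff (w (\<not> l)) (i (\<not> l)) n) \<and>
      safe \<I> w (Answered k i l ((\<lambda>_. n)(l := m))))"
proof -
  have "safe \<I> w (Picked k i l m) \<longleftrightarrow>
      (\<exists>i'. i' l = m \<and> i (\<not> l) < i' (\<not> l) \<and>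
        same_region \<I> (datum_diff (w False) (i False) (i' False))
          (datum_diff (w True) (i True) (i' True)) \<and>
        safe \<I> w (Answered k i l i'))"
    by (subst safe.simps)
      (auto elim!: spoiler_move.cases duplicator_move.cases
        intro: duplicator_move.answer dest: safe_Answered[THEN iffD1] safe_Round_imp_agree)
  then show ?thesis
    unfolding same_region_bool_iff[of \<I> "\<lambda>b. datum_diff (w b) (i b) (i' b)" l for i']
    by (simp add: ex_bool_fun_iff[where l = l])
qed

lemma safe_Round_Suc:
  "safe \<I> w (Round (Suc k) i) \<longleftrightarrow>
    agree w i \<and>
    (\<forall>l. \<forall>m>i l. \<exists>n>i (\<not> l).
      same_region \<I> (datum_diff (w l) (i l) m) (datum_diff (w (\<not> l)) (i (\<not> l)) n) \<and>
      safe \<I> w (Round k ((\<lambda>_. n)(l := m))) \<and>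
      (\<forall>n'\<in>{i (\<not> l)<..<n}. \<exists>m'\<in>{i l<..<m}. safe \<I> w (Round k ((\<lambda>_. n')(l := m')))))"
proof -
  have "safe \<I> w (Round (Suc k) i) \<longleftrightarrow>
      agree w i \<and> (\<forall>l. \<forall>m>i l. safe \<I> w (Picked k i l m))"
    by (subst safe.simps) (auto elim!: spoiler_move.cases intro: spoiler_move.intros)
  then show ?thesis by (simp add: safe_Picked safe_Answered safe_Inner)
qed

section \<open>Regions and intervals\<close>

lemma same_region_compare:
  assumes "same_region \<I> m n" "a \<in> \<I>"
  shows "a \<le> Fin m \<longleftrightarrow> a \<le> Fin n" "a < Fin m \<longleftrightarrow> a < Fin n"
    "Fin m \<le> a \<longleftrightarrow> Fin n \<le> a" "Fin m < a \<longleftrightarrow> Fin n < a"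
proof -
  have "m = n \<or> a < Fin m \<and> a < Fin n \<or> Fin m < a \<and> Fin n < a"
    using assms(1) unfolding same_region_def
  proof (elim disjE conjE exE)
    fix b c assume bc: "consecutive \<I> b c" "Fin m \<in> {b<..<c}" "Fin n \<in> {b<..<c}"
    then have "a \<le> b \<or> c \<le> a" using assms(2) unfolding consecutive_def by (meson not_le)
    then show ?thesis using bc(2,3) by auto
  qed simp
  then show "a \<le> Fin m \<longleftrightarrow> a \<le> Fin n" "a < Fin m \<longleftrightarrow> a < Fin n"
    "Fin m \<le> a \<longleftrightarrow> Fin n \<le> a" "Fin m < a \<longleftrightarrow> Fin n < a"
    by auto
qed

lemma same_region_imp_ints_in_iff:
  assumes "same_region \<I> m n" "endpoints J \<subseteq> \<I>"
  shows "m \<in> ints_in J \<longleftrightarrow> n \<in> ints_in J"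
  using assms(2) by (cases J) (auto simp: same_region_compare[OF assms(1)])

lemma ex_consecutive_around:
  assumes "finite \<I>" "x \<notin> \<I>" "a \<in> \<I>" "a < x" "b \<in> \<I>" "x < b"
  obtains a' b' where "consecutive \<I> a' b'" "a' < x" "x < b'"
proof
  define lower where "lower = {c \<in> \<I>. c < x}"
  define upper where "upper = {c \<in> \<I>. x < c}"
  have finite: "finite lower" "finite upper" using assms(1) by (simp_all add: lower_def upper_def)
  have "lower \<noteq> {}" "upper \<noteq> {}" using assms(3-6) by (auto simp: lower_def upper_def)
  then have mem: "Max lower \<in> lower" "Min upper \<in> upper" using finite by simp_all
  then show "Max lower < x" "x < Min upper" by (simp_all add: lower_def upper_def)
  then have "Max lower < Min upper" by simp
  moreover have "c \<le> Max lower \<or> Min upper \<le> c" if "c \<in> \<I>" for c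
  proof -
    have "c \<in> lower \<or> c \<in> upper"
      using that assms(2) by (cases c x rule: linorder_cases) (auto simp: lower_def upper_def)
    then show ?thesis using finite by auto
  qed
  ultimately show "consecutive \<I> (Max lower) (Min upper)"
    using mem unfolding consecutive_def by (fastforce simp: lower_def upper_def)
qed

lemma FConsD:
  assumes "\<I> \<in> FCons"
  shows "finite \<I>" "Minf \<in> \<I>" "Pinf \<in> \<I>"
  using assms by (auto simp: FCons_def)

lemma ex_region_interval:
  assumes "\<I> \<in> FCons"
  obtains J where "endpoints J \<subseteq> \<I>" "d \<in> ints_in J"
    "\<And>e. e \<in> ints_in J \<Longrightarrow> same_region \<I> d e"
proof (cases "Fin d \<in> \<I>")
  case True
  then show thesis by (intro that[of "Closed (Fin d) (Fin d)"]) (auto simp: same_region_def)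
next
  case False
  obtain a b where ab: "consecutive \<I> a b" "a < Fin d" "Fin d < b"
    using ex_consecutive_around[OF FConsD(1)[OF assms] False FConsD(2)[OF assms] _
        FConsD(3)[OF assms]] by auto
  show thesis
  proof (rule that[of "Open a b"])
    fix e assume "e \<in> ints_in (Open a b)"
    then have e: "a < Fin e" "Fin e < b" by simp_all
    then have "Fin e \<notin> \<I>" using ab(1) unfolding consecutive_def by blast
    then show "same_region \<I> d e" using False ab e unfolding same_region_def by auto
  qed (use ab in \<open>auto simp: consecutive_def\<close>)
qed

lemma finite_intervals:
  assumes "finite \<I>"
  shows "finite {J. endpoints J \<subseteq> \<I>}"
proof (rule finite_subset)
  show "{J. endpoints J \<subseteq> \<I>} \<subseteq>
      (\<Union>f\<in>{Closed, Open, Left_Open, Right_Open}. \<Union>a\<in>\<I>. \<Union>b\<in>\<I>. {f a b})"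
    (is "_ \<subseteq> ?U")
  proof
    fix J assume "J \<in> {J. endpoints J \<subseteq> \<I>}"
    then show "J \<in> ?U" by (cases J) auto
  qed
qed (use assms in simp)

section \<open>Types and the formulas defining them\<close>

definition mtl_type :: "'p mtl set \<Rightarrow> 'p data_word \<Rightarrow> nat \<Rightarrow> 'p mtl set" where
  "mtl_type \<Phi> w i = {\<phi> \<in> \<Phi>. sat w i \<phi>}"

lemma mtl_type_eq_iff:
  "mtl_type \<Phi> v i = mtl_type \<Phi> w j \<longleftrightarrow> (\<forall>\<phi>\<in>\<Phi>. sat v i \<phi> \<longleftrightarrow> sat w j \<phi>)"
  by (auto simp: mtl_type_def)

lemma mtl_type_subset: "mtl_type \<Phi> w i \<subseteq> \<Phi>"
  by (auto simp: mtl_type_def)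

lemma MTL_simps [simp]:
  "Prop p \<in> MTL \<I> k"
  "Neg \<phi> \<in> MTL \<I> k \<longleftrightarrow> \<phi> \<in> MTL \<I> k"
  "Conj \<phi> \<psi> \<in> MTL \<I> k \<longleftrightarrow> \<phi> \<in> MTL \<I> k \<and> \<psi> \<in> MTL \<I> k"
  "Until \<phi> J \<psi> \<notin> MTL \<I> 0"
  "Until \<phi> J \<psi> \<in> MTL \<I> (Suc k) \<longleftrightarrow>
    \<phi> \<in> MTL \<I> k \<and> endpoints J \<subseteq> \<I> \<and> \<psi> \<in> MTL \<I> k"
  by (auto simp: MTL_def)

definition verum :: "'p mtl" where
  "verum = Neg (Conj (Prop undefined) (Neg (Prop undefined)))"

definition Big_Conj :: "'p mtl set \<Rightarrow> 'p mtl" where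
  "Big_Conj \<Phi> = foldr Conj (SOME \<phi>s. set \<phi>s = \<Phi>) verum"

definition Big_Disj :: "'p mtl set \<Rightarrow> 'p mtl" where
  "Big_Disj \<Phi> = Neg (Big_Conj (Neg ` \<Phi>))"

lemma Big_Conj_eq_foldr:
  assumes "finite \<Phi>"
  obtains \<phi>s where "set \<phi>s = \<Phi>" "Big_Conj \<Phi> = foldr Conj \<phi>s verum"
  using someI_ex[OF finite_list[OF assms]] by (simp add: Big_Conj_def)

lemma sat_Big_Conj:
  assumes "finite \<Phi>"
  shows "sat w i (Big_Conj \<Phi>) \<longleftrightarrow> (\<forall>\<phi>\<in>\<Phi>. sat w i \<phi>)"
proof -
  have "sat w i (foldr Conj \<phi>s verum) \<longleftrightarrow> (\<forall>\<phi>\<in>set \<phi>s. sat w i \<phi>)" for \<phi>s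
    by (induction \<phi>s) (auto simp: verum_def)
  then show ?thesis by (metis Big_Conj_eq_foldr[OF assms])
qed

lemma Big_Conj_in_MTL:
  assumes "finite \<Phi>" "\<Phi> \<subseteq> MTL \<I> k"
  shows "Big_Conj \<Phi> \<in> MTL \<I> k"
proof -
  have "foldr Conj \<phi>s verum \<in> MTL \<I> k" if "set \<phi>s \<subseteq> MTL \<I> k" for \<phi>s
    using that by (induction \<phi>s) (auto simp: verum_def)
  then show ?thesis using assms(2) by (metis Big_Conj_eq_foldr[OF assms(1)])
qed

lemma sat_Big_Disj: "finite \<Phi> \<Longrightarrow> sat w i (Big_Disj \<Phi>) \<longleftrightarrow> (\<exists>\<phi>\<in>\<Phi>. sat w i \<phi>)"
  by (simp add: Big_Disj_def sat_Big_Conj)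

lemma Big_Disj_in_MTL: "finite \<Phi> \<Longrightarrow> \<Phi> \<subseteq> MTL \<I> k \<Longrightarrow> Big_Disj \<Phi> \<in> MTL \<I> k"
  by (auto simp: Big_Disj_def intro!: Big_Conj_in_MTL)

definition type_formula :: "'p mtl set \<Rightarrow> 'p mtl set \<Rightarrow> 'p mtl" where
  "type_formula \<Phi> S = Big_Conj ((\<lambda>\<phi>. if \<phi> \<in> S then \<phi> else Neg \<phi>) ` \<Phi>)"

lemma sat_type_formula:
  assumes "finite \<Phi>" "S \<subseteq> \<Phi>"
  shows "sat w i (type_formula \<Phi> S) \<longleftrightarrow> mtl_type \<Phi> w i = S"
proof -
  have sat_literal: "sat w i (if \<phi> \<in> S then \<phi> else Neg \<phi>) \<longleftrightarrow> (sat w i \<phi> \<longleftrightarrow> \<phi> \<in> S)" for \<phi>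
    by simp
  have "sat w i (type_formula \<Phi> S) \<longleftrightarrow> (\<forall>\<phi>\<in>\<Phi>. sat w i \<phi> \<longleftrightarrow> \<phi> \<in> S)"
    unfolding type_formula_def
    by (simp only: sat_Big_Conj[OF finite_imageI[OF assms(1)]] ball_simps sat_literal)
  then show ?thesis using assms(2) by (auto simp: mtl_type_def)
qed

lemma type_formula_in_MTL: "finite \<Phi> \<Longrightarrow> \<Phi> \<subseteq> MTL \<I> k \<Longrightarrow> type_formula \<Phi> S \<in> MTL \<I> k"
  unfolding type_formula_def by (rule Big_Conj_in_MTL) auto

fun mtl_basis :: "int extended set \<Rightarrow> nat \<Rightarrow> 'p mtl set" where
  "mtl_basis \<I> 0 = range Prop"
| "mtl_basis \<I> (Suc k) = range Prop \<union>
    (\<lambda>(T, J, S). Until (Big_Disj (type_formula (mtl_basis \<I> k) ` T)) J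
      (type_formula (mtl_basis \<I> k) S)) `
    (Pow (Pow (mtl_basis \<I> k)) \<times> {J. endpoints J \<subseteq> \<I>} \<times> Pow (mtl_basis \<I> k))"

lemma range_Prop_subset_mtl_basis: "range Prop \<subseteq> mtl_basis \<I> k"
  by (cases k) auto

lemma finite_mtl_basis: "finite \<I> \<Longrightarrow> finite (mtl_basis \<I> k :: 'p::finite mtl set)"
  by (induction k) (simp_all add: finite_intervals)

lemma mtl_basis_subset_MTL:
  assumes "finite \<I>"
  shows "(mtl_basis \<I> k :: 'p::finite mtl set) \<subseteq> MTL \<I> k"
proof (induction k)
  case (Suc k)
  let ?B = "mtl_basis \<I> k :: 'p mtl set"
  have B: "finite ?B" using finite_mtl_basis[OF assms] .
  then have type: "type_formula ?B S \<in> MTL \<I> k" for S using Suc.IH by (rule type_formula_in_MTL)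
  have "Big_Disj (type_formula ?B ` T) \<in> MTL \<I> k" if "T \<subseteq> Pow ?B" for T
  proof (rule Big_Disj_in_MTL)
    show "finite (type_formula ?B ` T)" using that B by (simp add: finite_subset)
    show "type_formula ?B ` T \<subseteq> MTL \<I> k" using type by blast
  qed
  then show ?case using type by auto
qed auto

section \<open>The game characterises equivalence\<close>

lemma safe_imp_sat:
  assumes "safe \<I> w (Round k i)" "\<phi> \<in> MTL \<I> k" "sat (w l) (i l) \<phi>"
  shows "sat (w (\<not> l)) (i (\<not> l)) \<phi>"
  using assms
proof (induction \<phi> arbitrary: k i l)
  case (Prop p)
  then show ?case using safe_Round_imp_agree[OF Prop.prems(1)] by (cases l) (auto simp: agree_def)
next
  case (Neg \<phi>)
  then show ?case using Neg.IH[of k i "\<not> l"] by auto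
next
  case (Conj \<phi> \<psi>)
  then show ?case by auto
next
  case (Until \<phi> J \<psi>)
  then obtain k' where k: "k = Suc k'" by (cases k) auto
  have subformulas: "\<phi> \<in> MTL \<I> k'" "\<psi> \<in> MTL \<I> k'" "endpoints J \<subseteq> \<I>"
    using Until.prems(2) by (simp_all add: k)
  obtain m where m: "i l < m" "sat (w l) m \<psi>" "datum_diff (w l) (i l) m \<in> ints_in J"
    "\<And>n. i l < n \<Longrightarrow> n < m \<Longrightarrow> sat (w l) n \<phi>"
    using Until.prems(3) by auto
  obtain n where n: "i (\<not> l) < n"
    "same_region \<I> (datum_diff (w l) (i l) m) (datum_diff (w (\<not> l)) (i (\<not> l)) n)"
    "safe \<I> w (Round k' ((\<lambda>_. n)(l := m)))"
    "\<And>n'. n' \<in> {i (\<not> l)<..<n} \<Longrightarrow>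
      \<exists>m'\<in>{i l<..<m}. safe \<I> w (Round k' ((\<lambda>_. n')(l := m')))"
    using Until.prems(1) m(1) unfolding k safe_Round_Suc by metis
  have "sat (w (\<not> l)) n \<psi>" using Until.IH(2)[OF n(3) subformulas(2), of l] m(2) by simp
  moreover have "datum_diff (w (\<not> l)) (i (\<not> l)) n \<in> ints_in J"
    using same_region_imp_ints_in_iff[OF n(2) subformulas(3)] m(3) by simp
  moreover have "sat (w (\<not> l)) n' \<phi>" if between: "n' \<in> {i (\<not> l)<..<n}" for n'
  proof -
    obtain m' where m': "m' \<in> {i l<..<m}" "safe \<I> w (Round k' ((\<lambda>_. n')(l := m')))"
      using n(4)[OF between] by blast
    then show ?thesis using Until.IH(1)[OF m'(2) subformulas(1), of l] m(4) by simp
  qed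
  ultimately show ?case using n(1) by auto
qed

lemma safe_imp_mtl_type_eq:
  assumes "safe \<I> w (Round k i)"
  shows "mtl_type (MTL \<I> k) (w False) (i False) = mtl_type (MTL \<I> k) (w True) (i True)"
  using safe_imp_sat[OF assms, of _ False] safe_imp_sat[OF assms, of _ True]
  by (auto simp: mtl_type_def)

lemma mtl_type_eq_imp_agree:
  assumes "range Prop \<subseteq> \<Phi>"
    and "mtl_type \<Phi> (w False) (i False) = mtl_type \<Phi> (w True) (i True)"
  shows "agree w i"
proof -
  have "sat (w False) (i False) (Prop p) \<longleftrightarrow> sat (w True) (i True) (Prop p)" for p
    using assms unfolding mtl_type_eq_iff by blast
  then show ?thesis by (auto simp: agree_def)
qed

lemma mtl_basis_Suc_type_eq_imp_answer:
  fixes v w :: "'p::finite data_word"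
  assumes "\<I> \<in> FCons" "i < m"
    and type_eq: "mtl_type (mtl_basis \<I> (Suc k)) v i = mtl_type (mtl_basis \<I> (Suc k)) w j"
  obtains n where "j < n" "same_region \<I> (datum_diff v i m) (datum_diff w j n)"
    "mtl_type (mtl_basis \<I> k) v m = mtl_type (mtl_basis \<I> k) w n"
    "\<And>n'. n' \<in> {j<..<n} \<Longrightarrow>
      \<exists>m'\<in>{i<..<m}. mtl_type (mtl_basis \<I> k) v m' = mtl_type (mtl_basis \<I> k) w n'"
proof -
  let ?B = "mtl_basis \<I> k :: 'p mtl set"
  have B: "finite ?B" using finite_mtl_basis[OF FConsD(1)[OF assms(1)]] .
  obtain J where J: "endpoints J \<subseteq> \<I>" "datum_diff v i m \<in> ints_in J"
    "\<And>e. e \<in> ints_in J \<Longrightarrow> same_region \<I> (datum_diff v i m) e"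
    using ex_region_interval[OF assms(1)] by blast
  let ?T = "mtl_type ?B v ` {i<..<m}"
  let ?\<phi> = "Big_Disj (type_formula ?B ` ?T)" and ?\<psi> = "type_formula ?B (mtl_type ?B v m)"
  have sat_\<phi>: "sat u x ?\<phi> \<longleftrightarrow> (\<exists>m'\<in>{i<..<m}. mtl_type ?B v m' = mtl_type ?B u x)" for u x
    by (auto simp: sat_Big_Disj sat_type_formula[OF B mtl_type_subset])
  have sat_\<psi>: "sat u x ?\<psi> \<longleftrightarrow> mtl_type ?B v m = mtl_type ?B u x" for u x
    by (auto simp: sat_type_formula[OF B mtl_type_subset])
  have "sat v i (Until ?\<phi> J ?\<psi>)"
    using assms(2) J(2) by (auto simp: sat_\<phi> sat_\<psi> intro!: exI[of _ m])
  moreover have "Until ?\<phi> J ?\<psi> \<in> mtl_basis \<I> (Suc k)"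
    using J(1) mtl_type_subset[of ?B v]
    by (auto intro!: image_eqI[of _ _ "(?T, J, mtl_type ?B v m)"] dest: subsetD)
  ultimately have "sat w j (Until ?\<phi> J ?\<psi>)" using type_eq unfolding mtl_type_eq_iff by blast
  then obtain n where "j < n" "sat w n ?\<psi>" "datum_diff w j n \<in> ints_in J"
    "\<And>n'. n' \<in> {j<..<n} \<Longrightarrow> sat w n' ?\<phi>"
    by auto
  then show thesis by (intro that[of n]) (simp_all only: sat_\<phi> sat_\<psi> J(3))
qed

lemma mtl_basis_type_eq_imp_safe:
  fixes w :: "bool \<Rightarrow> 'p::finite data_word"
  assumes "\<I> \<in> FCons"
    and "mtl_type (mtl_basis \<I> k) (w False) (i False) = mtl_type (mtl_basis \<I> k) (w True) (i True)"
  shows "safe \<I> w (Round k i)"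
  using assms(2)
proof (induction k arbitrary: i)
  case 0
  then show ?case
    using mtl_type_eq_imp_agree[OF range_Prop_subset_mtl_basis] by (simp only: safe_Round_0)
next
  case (Suc k)
  let ?type = "\<lambda>l. mtl_type (mtl_basis \<I> k) (w l)"
  have safe_upd: "safe \<I> w (Round k ((\<lambda>_. n)(l := m)))" if "?type l m = ?type (\<not> l) n" for l m n
    using that by (intro Suc.IH) (cases l; simp)
  show ?case
    unfolding safe_Round_Suc
  proof (intro conjI allI impI)
    show "agree w i" using mtl_type_eq_imp_agree[OF range_Prop_subset_mtl_basis Suc.prems] .
  next
    fix l m assume "i l < m"
    moreover have "mtl_type (mtl_basis \<I> (Suc k)) (w l) (i l) =
        mtl_type (mtl_basis \<I> (Suc k)) (w (\<not> l)) (i (\<not> l))"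
      using Suc.prems by (cases l) simp_all
    ultimately obtain n where n: "i (\<not> l) < n"
      "same_region \<I> (datum_diff (w l) (i l) m) (datum_diff (w (\<not> l)) (i (\<not> l)) n)"
      "?type l m = ?type (\<not> l) n"
      "\<And>n'. n' \<in> {i (\<not> l)<..<n} \<Longrightarrow> \<exists>m'\<in>{i l<..<m}. ?type l m' = ?type (\<not> l) n'"
      using mtl_basis_Suc_type_eq_imp_answer[OF assms(1)] by blast
    then show "\<exists>n>i (\<not> l).
        same_region \<I> (datum_diff (w l) (i l) m) (datum_diff (w (\<not> l)) (i (\<not> l)) n) \<and>
        safe \<I> w (Round k ((\<lambda>_. n)(l := m))) \<and>
        (\<forall>n'\<in>{i (\<not> l)<..<n}. \<exists>m'\<in>{i l<..<m}. safe \<I> w (Round k ((\<lambda>_. n')(l := m'))))"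
      using safe_upd by blast
  qed
qed

theorem theorem1:
  fixes \<I> :: "int extended set" and k :: nat
    and w\<^sub>0 w\<^sub>1 :: "('p::finite) data_word" and i\<^sub>0 i\<^sub>1 :: nat
  assumes "\<I> \<in> FCons"
  shows "(\<forall>\<phi> \<in> MTL \<I> k. sat w\<^sub>0 i\<^sub>0 \<phi> \<longleftrightarrow> sat w\<^sub>1 i\<^sub>1 \<phi>) \<longleftrightarrow>
         duplicator_wins_MG \<I> k w\<^sub>0 i\<^sub>0 w\<^sub>1 i\<^sub>1"
  unfolding duplicator_wins_MG_iff_safe
proof
  assume "\<forall>\<phi> \<in> MTL \<I> k. sat w\<^sub>0 i\<^sub>0 \<phi> \<longleftrightarrow> sat w\<^sub>1 i\<^sub>1 \<phi>"
  then have "mtl_type (mtl_basis \<I> k) w\<^sub>0 i\<^sub>0 = mtl_type (mtl_basis \<I> k) w\<^sub>1 i\<^sub>1"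
    using mtl_basis_subset_MTL[OF FConsD(1)[OF assms]] unfolding mtl_type_eq_iff by blast
  then show "safe \<I> (\<lambda>l. if l then w\<^sub>1 else w\<^sub>0) (Round k (\<lambda>l. if l then i\<^sub>1 else i\<^sub>0))"
    by (intro mtl_basis_type_eq_imp_safe[OF assms]) simp
next
  assume "safe \<I> (\<lambda>l. if l then w\<^sub>1 else w\<^sub>0) (Round k (\<lambda>l. if l then i\<^sub>1 else i\<^sub>0))"
  from safe_imp_mtl_type_eq[OF this]
  show "\<forall>\<phi> \<in> MTL \<I> k. sat w\<^sub>0 i\<^sub>0 \<phi> \<longleftrightarrow> sat w\<^sub>1 i\<^sub>1 \<phi>"
    by (simp add: mtl_type_eq_iff)
qed

end
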